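(* Let $A_0,A_1,\ldots,A_n$ be real symmetric $q\times q$ matrices, let $G(\boldsymbol{x})=A_0+\sum_{i=1}^n A_i x_i$, and let $\mathbf{K}=\{\boldsymbol{x}\in\mathbb{R}^n \mid G(\boldsymbol{x})\succeq 0\}$. Suppose that $\mathbf{K}$ is compact and has nonempty interior. If a polynomial $f(\boldsymbol{x})\in\mathbb{R}[\boldsymbol{x}]$ is positive on $\mathbf{K}$ (i.e. $f(\boldsymbol{u})>0$ for all $\boldsymbol{u}\in\mathbf{K}$), then $f\in\mathcal{H}(G)$.
   Context: $\boldsymbol{x}=(x_1,\ldots,x_n)$; $\mathbb{R}[\boldsymbol{x}]$ is the ring of real polynomials in $\boldsymbol{x}$; $\mathbb{N}$ is the set of nonnegative integers; $\mathbb{R}_+$ the nonnegative reals; $[m]=\{1,\ldots,m\}$. $\mathbb{S}^{q}_+$ is the set of $q\times q$ real symmetric positive semidefinite matrices; $\langle A,B\rangle=\mathrm{tr}(A^{\intercal}B)$; $U^{\otimes k}=U\otimes\cdots\otimes U$ ($k$ times, Kronecker product). For linear (i.e. affine) $G(\boldsymbol{x})$ as in the claim, $$\mathcal{H}(G):=\Big\{\lambda_0+\sum_{k=1}^m\langle\Lambda_k,G(\boldsymbol{x})^{\otimes k}\rangle\ \Big|\ m\in\mathbb{N},\ \lambda_0\in\mathbb{R}_+,\ \Lambda_k\in\mathbb{S}^{q^k}_+,\ k\in[m]\Big\}\subset\mathbb{R}[\boldsymbol{x}].$$ *)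

theory Defs
  imports
    "HOL-Analysis.Analysis"
    "HOL-Library.Poly_Mapping"
    "Jordan_Normal_Form.Matrix"
begin

(* Both libraries use $ for vector components and \<bullet> for inner products.  Here $ is the
   component of a point of real ^ 'n and \<bullet> is the scalar product of Jordan_Normal_Form. *)
no_notation vec_index (infixl \<open>$\<close> 100)
unbundle no inner_syntax

text \<open>
  The polynomial ring in the variables indexed by \<open>'n\<close>: finitely supported maps from
  monomials (exponent vectors) to coefficients. The ring structure (convolution product) is the
  one of \<^theory>\<open>HOL-Library.Poly_Mapping\<close>.
\<close>

type_synonym 'n rpoly = "('n \<Rightarrow>\<^sub>0 nat) \<Rightarrow>\<^sub>0 real"

definition Const :: "real \<Rightarrow> 'n rpoly" where
  "Const c = Poly_Mapping.single 0 c"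

definition Var :: "'n \<Rightarrow> 'n rpoly" where
  "Var i = Poly_Mapping.single (Poly_Mapping.single i 1) 1"

definition peval :: "'n::finite rpoly \<Rightarrow> real ^ 'n \<Rightarrow> real" where
  "peval p u = (\<Sum>m\<in>Poly_Mapping.keys p.
     Poly_Mapping.lookup p m * (\<Prod>i\<in>UNIV. (u $ i) ^ Poly_Mapping.lookup m i))"

definition sym_mats :: "nat \<Rightarrow> real mat set" where
  "sym_mats q = {M \<in> carrier_mat q q. transpose_mat M = M}"

definition psd_mats :: "nat \<Rightarrow> real mat set" where
  "psd_mats q = {M \<in> sym_mats q. \<forall>v \<in> carrier_vec q. 0 \<le> v \<bullet> (M *\<^sub>v v)}"

definition mat_trace :: "'a::comm_monoid_add mat \<Rightarrow> 'a" where
  "mat_trace M = (\<Sum>i<dim_row M. M $$ (i, i))"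

definition mat_inner :: "'a::comm_semiring_0 mat \<Rightarrow> 'a mat \<Rightarrow> 'a" where
  "mat_inner M N = mat_trace (transpose_mat M * N)"

definition kron :: "'a::times mat \<Rightarrow> 'a mat \<Rightarrow> 'a mat" where
  "kron M N = mat (dim_row M * dim_row N) (dim_col M * dim_col N)
     (\<lambda>(i, j). M $$ (i div dim_row N, j div dim_col N) * N $$ (i mod dim_row N, j mod dim_col N))"

fun kron_pow :: "'a::comm_semiring_1 mat \<Rightarrow> nat \<Rightarrow> 'a mat" where
  "kron_pow M 0 = 1\<^sub>m 1"
| "kron_pow M (Suc k) = kron M (kron_pow M k)"

definition linear_pencil ::
  "nat \<Rightarrow> real mat \<Rightarrow> ('n::finite \<Rightarrow> real mat) \<Rightarrow> 'n rpoly mat" where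
  "linear_pencil q A0 A = mat q q (\<lambda>(r, c).
     Const (A0 $$ (r, c)) + (\<Sum>i\<in>UNIV. Const (A i $$ (r, c)) * Var i))"

definition psd_region :: "nat \<Rightarrow> 'n::finite rpoly mat \<Rightarrow> (real ^ 'n) set" where
  "psd_region q G = {u. map_mat (\<lambda>p. peval p u) G \<in> psd_mats q}"

text \<open>The real matrices \<open>\<Lambda> k\<close> are embedded into matrices of constant polynomials.\<close>

definition handelman_cone :: "nat \<Rightarrow> 'n::finite rpoly mat \<Rightarrow> 'n rpoly set" where
  "handelman_cone q G =
     {Const l0 + (\<Sum>k = 1..m. mat_inner (map_mat Const (\<Lambda> k)) (kron_pow G k)) | m l0 \<Lambda>.
        0 \<le> l0 \<and> (\<forall>k \<in> {1..m}. \<Lambda> k \<in> psd_mats (q ^ k))}"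

end

theory Submission
  imports Defs
begin

text \<open>
  Let \<open>T\<close> be the set of all polynomials \<open>p\<close> whose multiples \<open>p * h\<close> stay in the cone \<open>H\<close> for every \<open>h\<close>
  in \<open>H\<close>. It is closed under addition and multiplication, it contains the nonnegative constants, and it
  lies inside \<open>H\<close> because \<open>1\<close> does. It also contains every quadratic form \<open>w\<^sup>T G w\<close>: multiplying
  \<open>\<langle>\<Lambda>, G\<^bsup>\<otimes>k\<^esup>\<rangle>\<close> by \<open>w\<^sup>T G w\<close> gives \<open>\<langle>w w\<^sup>T \<otimes> \<Lambda>, G\<^bsup>\<otimes>(k+1)\<^esup>\<rangle>\<close>, and \<open>w w\<^sup>T \<otimes> \<Lambda>\<close> is positive semidefinite by a
  direct computation (\<open>psd_mats_kron_rank_one\<close>). So it suffices to show \<open>f \<in> T\<close>,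
  and this holds because \<open>T\<close> is a semiring containing the nonnegative constants and these forms.

  The semiring \<open>T\<close> is Archimedean: every polynomial is bounded above by a constant modulo \<open>T\<close>. The
  polynomials bounded on both sides form a subring (\<open>bounded_rpoly\<close>), so only the coordinates have to
  be bounded. If a linear form plus any constant never lay in \<open>T\<close>, a hyperplane would separate the
  vertical line over this form from the cone of affine polynomials in \<open>T\<close>. Its normal vector \<open>\<beta>\<close> would satisfy
  \<open>w\<^sup>T (\<Sum>k. \<beta>\<^sub>k A\<^sub>k) w \<ge> 0\<close> for all \<open>w\<close>, hence be a nonzero recession direction of the compact set \<open>K\<close>, which
  is impossible (\<open>bounded_imp_cone_meets_vertical_line\<close>).

  For an Archimedean semiring, an element that is positive under all characters that are nonnegative on the semiring
  belongs to the semiring (\<open>positive_imp_mem\<close>). A character of the polynomial ring is the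
  evaluation at some point \<open>u\<close>, and nonnegativity on the forms \<open>w\<^sup>T G w\<close> says exactly that \<open>G(u)\<close> is positive
  semidefinite, that is \<open>u \<in> K\<close>, where \<open>f\<close> is positive by assumption.
\<close>

section \<open>The representation theorem for Archimedean semirings\<close>

text \<open>
  The map \<open>\<iota>\<close> embeds the constants, and \<open>T\<close> consists of elements with a certificate of nonnegativity.
  The last assumption is the algebraic counterpart of compactness.
\<close>
locale archimedean_semiring =
  fixes \<iota> :: "real \<Rightarrow> 'a::comm_ring_1" and T :: "'a set"
  assumes emb_1: "\<iota> 1 = 1"
    and emb_add: "\<iota> (x + y) = \<iota> x + \<iota> y"
    and emb_mult: "\<iota> (x * y) = \<iota> x * \<iota> y"
    and emb_in: "0 \<le> c \<Longrightarrow> \<iota> c \<in> T"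
    and add_in: "a \<in> T \<Longrightarrow> b \<in> T \<Longrightarrow> a + b \<in> T"
    and mult_in: "a \<in> T \<Longrightarrow> b \<in> T \<Longrightarrow> a * b \<in> T"
    and bounded: "\<exists>N. \<iota> N - a \<in> T"
begin

lemma emb_0: "\<iota> 0 = 0"
  using emb_add[of 0 0] by simp

lemma emb_minus: "\<iota> (- x) = - \<iota> x"
  using emb_add[of x "- x"] emb_0 by (metis add.right_inverse add_eq_0_iff)

lemma emb_diff: "\<iota> (x - y) = \<iota> x - \<iota> y"
  using emb_add[of x "- y"] emb_minus by simp

lemma one_in: "1 \<in> T"
  using emb_in[of 1] emb_1 by simp

lemma bounded_nonneg: "\<exists>N\<ge>0. \<iota> N - a \<in> T"
proof -
  obtain N where N: "\<iota> N - a \<in> T" using bounded by blast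
  have "\<iota> (max 0 N) - a = \<iota> (max 0 N - N) + (\<iota> N - a)"
    by (simp add: emb_diff)
  moreover have "\<iota> (max 0 N - N) \<in> T"
    by (rule emb_in) simp
  ultimately have "\<iota> (max 0 N) - a \<in> T"
    using N by (metis add_in)
  then show ?thesis by (intro exI[of _ "max 0 N"]) simp
qed

text \<open>
  Proper modules are approximations to the nonnegativity cone of a character; a maximal one determines
  such a character.
\<close>
definition proper_module :: "'a set \<Rightarrow> bool" where
  "proper_module M \<longleftrightarrow> T \<subseteq> M \<and> (\<forall>a\<in>M. \<forall>b\<in>M. a + b \<in> M)
     \<and> (\<forall>t\<in>T. \<forall>a\<in>M. t * a \<in> M) \<and> - 1 \<notin> M"

lemma proper_moduleI:
  assumes "\<And>t. t \<in> T \<Longrightarrow> t \<in> M" "\<And>a b. a \<in> M \<Longrightarrow> b \<in> M \<Longrightarrow> a + b \<in> M"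
    and "\<And>t a. t \<in> T \<Longrightarrow> a \<in> M \<Longrightarrow> t * a \<in> M" "- 1 \<notin> M"
  shows "proper_module M"
  using assms unfolding proper_module_def by blast

lemma proper_moduleD:
  assumes "proper_module M"
  shows "t \<in> T \<Longrightarrow> t \<in> M" "a \<in> M \<Longrightarrow> b \<in> M \<Longrightarrow> a + b \<in> M"
    and "t \<in> T \<Longrightarrow> a \<in> M \<Longrightarrow> t * a \<in> M" "- 1 \<notin> M"
  using assms unfolding proper_module_def by blast+

text \<open>
  Adjoining one element is the only way in which modules get enlarged below. It is stated so that \<open>M\<close>
  may also be \<open>T\<close> itself, before it is known that \<open>- 1\<close> is not in \<open>T\<close>.
\<close>
lemma proper_module_adjoin:
  assumes sub: "T \<subseteq> M"
    and add: "\<forall>a\<in>M. \<forall>b\<in>M. a + b \<in> M"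
    and mult: "\<forall>t\<in>T. \<forall>a\<in>M. t * a \<in> M"
    and notin: "\<forall>m\<in>M. \<forall>t\<in>T. - 1 \<noteq> m + a * t"
  shows "proper_module {m + a * t | m t. m \<in> M \<and> t \<in> T}" (is "proper_module ?N")
    and "M \<subseteq> {m + a * t | m t. m \<in> M \<and> t \<in> T}"
    and "a \<in> {m + a * t | m t. m \<in> M \<and> t \<in> T}"
proof -
  have 0: "0 \<in> T" using emb_in[of 0] emb_0 by simp
  show MN: "M \<subseteq> ?N"
  proof
    fix m assume "m \<in> M"
    then have "m = m + a * 0 \<and> m \<in> M \<and> 0 \<in> T" using 0 by simp
    then show "m \<in> ?N" by blast
  qed
  have "a = 0 + a * 1 \<and> 0 \<in> M \<and> 1 \<in> T" using 0 one_in sub by auto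
  then show "a \<in> ?N" by blast
  show "proper_module ?N"
  proof (rule proper_moduleI)
    show "t \<in> ?N" if "t \<in> T" for t using that sub MN by blast
    show "x + y \<in> ?N" if "x \<in> ?N" "y \<in> ?N" for x y
    proof -
      from that obtain m t m' t' where
        *: "x = m + a * t" "y = m' + a * t'" "m \<in> M" "t \<in> T" "m' \<in> M" "t' \<in> T" by blast
      then have "x + y = (m + m') + a * (t + t') \<and> m + m' \<in> M \<and> t + t' \<in> T"
        using add add_in by (simp add: algebra_simps)
      then show ?thesis by blast
    qed
    show "s * x \<in> ?N" if "s \<in> T" "x \<in> ?N" for s x
    proof -
      from that obtain m t where *: "x = m + a * t" "m \<in> M" "t \<in> T" by blast
      have "s * x = s * m + a * (s * t)" unfolding *(1) by (simp add: algebra_simps)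
      moreover have "s * m \<in> M" "s * t \<in> T" using * mult mult_in that(1) by blast+
      ultimately show ?thesis by blast
    qed
    show "- 1 \<notin> ?N" using notin by blast
  qed
qed

lemma maximal_proper_module_exists:
  assumes "proper_module M0"
  obtains M where "proper_module M" "M0 \<subseteq> M"
    "\<And>N. proper_module N \<Longrightarrow> M \<subseteq> N \<Longrightarrow> N = M"
proof -
  let ?A = "{M. proper_module M \<and> M0 \<subseteq> M}"
  have "\<exists>M\<in>?A. \<forall>X\<in>?A. M \<subseteq> X \<longrightarrow> X = M"
  proof (rule subset_Zorn_nonempty)
    show "?A \<noteq> {}" using assms by blast
    fix C assume C: "C \<noteq> {}" "subset.chain ?A C"
    then have CA: "\<And>X. X \<in> C \<Longrightarrow> proper_module X \<and> M0 \<subseteq> X"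
      and tot: "\<And>X Y. X \<in> C \<Longrightarrow> Y \<in> C \<Longrightarrow> X \<subseteq> Y \<or> Y \<subseteq> X"
      unfolding subset_chain_def by blast+
    have "proper_module (\<Union>C)"
    proof (rule proper_moduleI)
      show "t \<in> \<Union>C" if "t \<in> T" for t
        using that C(1) CA proper_moduleD(1) by blast
      show "a + b \<in> \<Union>C" if ab: "a \<in> \<Union>C" "b \<in> \<Union>C" for a b
      proof -
        from ab obtain X Y where "X \<in> C" "Y \<in> C" "a \<in> X" "b \<in> Y" by blast
        with tot obtain Z where "Z \<in> C" "a \<in> Z" "b \<in> Z" by blast
        with CA proper_moduleD(2) show ?thesis by blast
      qed
      show "t * a \<in> \<Union>C" if "t \<in> T" "a \<in> \<Union>C" for t a
        using that CA proper_moduleD(3) by blast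
      show "- 1 \<notin> \<Union>C" using CA proper_moduleD(4) by blast
    qed
    then show "\<Union>C \<in> ?A" using C(1) CA by blast
  qed
  then obtain M where "proper_module M" "M0 \<subseteq> M"
    and "\<forall>X\<in>?A. M \<subseteq> X \<longrightarrow> X = M" by auto
  then show ?thesis using that[of M] by auto
qed

lemma emb_notin_proper_module:
  assumes M: "proper_module M" and "\<iota> x \<in> M"
  shows "0 \<le> x"
proof (rule ccontr)
  assume "\<not> 0 \<le> x"
  then have x: "x < 0" by simp
  then have "\<iota> (- 1 / x) * \<iota> x \<in> M"
    using proper_moduleD(3)[OF M] emb_in[of "- 1 / x"] assms(2)
    by (simp add: divide_le_0_iff)
  then have "\<iota> (- 1) \<in> M"
    unfolding emb_mult[symmetric] using x by simp
  then show False
    using proper_moduleD(4)[OF M] by (simp add: emb_minus emb_1)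
qed

text \<open>
  If neither \<open>a\<close> nor \<open>- a\<close> is in \<open>M\<close>, adjoining either of them produces \<open>- 1\<close>, so \<open>- 1 = m\<^sub>1 + a t\<^sub>1\<close> and \<open>- 1 = m\<^sub>2 - a t\<^sub>2\<close>. Eliminating \<open>a\<close>
  puts \<open>- t\<^sub>1\<close> into \<open>M\<close>; multiplying it by an element \<open>\<iota> N - a\<close> of \<open>T\<close> brings the first
  equation back and yields \<open>- 1 \<in> M\<close>.
\<close>
lemma maximal_proper_module_total:
  assumes M: "proper_module M" and max: "\<And>N. proper_module N \<Longrightarrow> M \<subseteq> N \<Longrightarrow> N = M"
  shows "a \<in> M \<or> - a \<in> M"
proof (rule ccontr)
  assume neg: "\<not> (a \<in> M \<or> - a \<in> M)"
  note D = proper_moduleD[OF M]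
  have ex: "\<exists>m t. m \<in> M \<and> t \<in> T \<and> - 1 = m + b * t" if "b \<notin> M" for b
  proof (rule ccontr)
    assume no: "\<not> ?thesis"
    have closed: "T \<subseteq> M" "\<forall>a\<in>M. \<forall>b\<in>M. a + b \<in> M" "\<forall>t\<in>T. \<forall>a\<in>M. t * a \<in> M"
      using M unfolding proper_module_def by blast+
    have "\<forall>m\<in>M. \<forall>t\<in>T. - 1 \<noteq> m + b * t" using no by blast
    note adjoin = proper_module_adjoin[OF closed this]
    show False using max[OF adjoin(1,2)] adjoin(3) that by simp
  qed
  obtain m1 t1 where 1: "m1 \<in> M" "t1 \<in> T" "- 1 = m1 + a * t1" using ex neg by blast
  obtain m2 t2 where 2: "m2 \<in> M" "t2 \<in> T" "- 1 = m2 + (- a) * t2" using ex neg by blast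
  have at1: "a * t1 = - 1 - m1" using 1(3) by (simp add: algebra_simps)
  have at2: "a * t2 = 1 + m2" using 2(3) by (simp add: algebra_simps eq_neg_iff_add_eq_0)
  have "- t1 = t2 + t2 * m1 + t1 * m2"
  proof -
    have "t2 * (a * t1) = t1 * (a * t2)" by (simp add: ac_simps)
    then have eq: "- t2 - t2 * m1 = t1 + t1 * m2" unfolding at1 at2 by (simp add: algebra_simps)
    have "t2 + t2 * m1 + t1 * m2 = - (- t2 - t2 * m1) + (t1 + t1 * m2) - t1" by simp
    also have "\<dots> = - t1" unfolding eq by simp
    finally show ?thesis ..
  qed
  then have t1: "- t1 \<in> M" using 1 2 D by simp
  obtain N where N: "0 \<le> N" "\<iota> N - a \<in> T" using bounded_nonneg by blast
  have "- 1 = (\<iota> N - a) * (- t1) + \<iota> N * t1 + m1"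
    using at1 by (simp add: algebra_simps)
  moreover have "(\<iota> N - a) * (- t1) + \<iota> N * t1 + m1 \<in> M"
    using D(3)[OF N(2) t1] D(3)[OF emb_in[OF N(1)] D(1)[OF 1(2)]] D(2) 1(1) by blast
  ultimately show False using D(4) by simp
qed

text \<open>
  For a total module, ``\<open>b - a \<in> M\<close>'' is a total preorder in which, by the Archimedean property, each
  element lies infinitely close to exactly one real number. The relational form makes
  algebraic identities between standard parts easy to check through uniqueness.
\<close>
definition is_standard_part :: "'a set \<Rightarrow> 'a \<Rightarrow> real \<Rightarrow> bool" where
  "is_standard_part M a x \<longleftrightarrow> (\<forall>e>0. \<iota> (x + e) - a \<in> M \<and> a - \<iota> (x - e) \<in> M)"

lemma standard_part_mono:
  assumes M: "proper_module M" and "is_standard_part M a x" "is_standard_part M b y" "b - a \<in> M"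
  shows "x \<le> y"
proof (rule field_le_epsilon)
  fix e :: real assume e: "0 < e"
  have "\<iota> (y + e/2) - b \<in> M" "a - \<iota> (x - e/2) \<in> M"
    using assms(2,3) e unfolding is_standard_part_def by simp_all
  then have "(\<iota> (y + e/2) - b) + (b - a) + (a - \<iota> (x - e/2)) \<in> M"
    using assms(4) proper_moduleD(2)[OF M] by blast
  moreover have "(\<iota> (y + e/2) - b) + (b - a) + (a - \<iota> (x - e/2)) = \<iota> (y + e/2 - (x - e/2))"
    unfolding emb_diff by simp
  ultimately have "0 \<le> y + e/2 - (x - e/2)"
    using emb_notin_proper_module[OF M] by metis
  then show "x \<le> y + e" by simp
qed

lemma zero_in_proper_module:
  assumes "proper_module M"
  shows "0 \<in> M"
  using proper_moduleD(1)[OF assms emb_in[of 0]] by (simp add: emb_0)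

lemma standard_part_unique:
  assumes "proper_module M" "is_standard_part M a x" "is_standard_part M a y"
  shows "x = y"
  using standard_part_mono[OF assms(1,2,3)] standard_part_mono[OF assms(1,3,2)]
    zero_in_proper_module[OF assms(1)] by simp

lemma standard_part_emb:
  assumes "proper_module M"
  shows "is_standard_part M (\<iota> c) c"
  unfolding is_standard_part_def emb_diff[symmetric]
  using proper_moduleD(1)[OF assms emb_in] by simp

lemma standard_part_add:
  assumes M: "proper_module M" and "is_standard_part M a x" "is_standard_part M b y"
  shows "is_standard_part M (a + b) (x + y)"
  unfolding is_standard_part_def
proof (intro allI impI conjI)
  fix e :: real assume e: "0 < e"
  have "\<iota> (x + e/2) - a \<in> M" "\<iota> (y + e/2) - b \<in> M" "a - \<iota> (x - e/2) \<in> M" "b - \<iota> (y - e/2) \<in> M"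
    using assms(2,3) e unfolding is_standard_part_def by simp_all
  then have sums: "(\<iota> (x + e/2) - a) + (\<iota> (y + e/2) - b) \<in> M"
    "(a - \<iota> (x - e/2)) + (b - \<iota> (y - e/2)) \<in> M"
    using proper_moduleD(2)[OF M] by blast+
  have "x + y + e = (x + e/2) + (y + e/2)" "x + y - e = (x - e/2) + (y - e/2)" by simp_all
  then have "\<iota> (x + y + e) - (a + b) = (\<iota> (x + e/2) - a) + (\<iota> (y + e/2) - b)"
    "a + b - \<iota> (x + y - e) = (a - \<iota> (x - e/2)) + (b - \<iota> (y - e/2))"
    by (simp_all only: emb_add) (simp_all add: algebra_simps)
  with sums show "\<iota> (x + y + e) - (a + b) \<in> M" "a + b - \<iota> (x + y - e) \<in> M" by (simp_all only:)
qed

lemma standard_part_exists: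
  assumes M: "proper_module M" and total: "\<And>a. a \<in> M \<or> - a \<in> M"
  shows "\<exists>x. is_standard_part M a x"
proof -
  note D = proper_moduleD[OF M]
  let ?U = "{r. \<iota> r - a \<in> M}"
  obtain N where "\<iota> N - a \<in> T" using bounded by blast
  then have ne: "?U \<noteq> {}" using D(1) by blast
  obtain N' where N': "\<iota> N' - (- a) \<in> T" using bounded by blast
  have lower: "- N' \<le> r" if "r \<in> ?U" for r
  proof -
    have "(\<iota> r - a) + (\<iota> N' - (- a)) \<in> M" using that D(2)[OF _ D(1)[OF N']] by (simp only: mem_Collect_eq)
    then have "\<iota> (r + N') \<in> M" by (simp add: emb_add)
    then show ?thesis using emb_notin_proper_module[OF M] by fastforce
  qed
  then have bdd: "bdd_below ?U" by (meson bdd_belowI)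
  have "is_standard_part M a (Inf ?U)"
    unfolding is_standard_part_def
  proof (intro allI impI conjI)
    fix e :: real assume e: "0 < e"
    then obtain r where r: "r \<in> ?U" "r < Inf ?U + e"
      using cInf_lessD[OF ne, of "Inf ?U + e"] by auto
    have "\<iota> (Inf ?U + e) - a = \<iota> (Inf ?U + e - r) + (\<iota> r - a)"
      by (simp add: emb_diff)
    then show "\<iota> (Inf ?U + e) - a \<in> M"
      using r D(2)[OF D(1)[OF emb_in[of "Inf ?U + e - r"]]] by (simp only: mem_Collect_eq)
    have "Inf ?U - e \<notin> ?U" using cInf_lower[OF _ bdd, of "Inf ?U - e"] e by auto
    then have "- (\<iota> (Inf ?U - e) - a) \<in> M" using total by blast
    then show "a - \<iota> (Inf ?U - e) \<in> M" by simp
  qed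
  then show ?thesis by blast
qed

text \<open>
  Taking standard parts is a character. Since \<open>M\<close> only absorbs factors from \<open>T\<close>, multiplicativity is
  obtained first for one factor in \<open>T\<close>, by multiplying the bounds on the other factor with it, and then in
  general by writing an element as a difference of an element of \<open>T\<close> and a nonnegative constant.
\<close>
lemma character_of_total_module:
  assumes M: "proper_module M" and total: "\<And>a. a \<in> M \<or> - a \<in> M"
  obtains L :: "'a \<Rightarrow> real" where "\<And>a b. L (a + b) = L a + L b" "\<And>a b. L (a * b) = L a * L b"
    "\<And>c. L (\<iota> c) = c" "\<And>a. a \<in> M \<Longrightarrow> 0 \<le> L a"
proof -
  note D = proper_moduleD[OF M]
  obtain L where L: "\<And>a. is_standard_part M a (L a)"
    using standard_part_exists[OF M total] by metis
  have eq: "L a = x" if "is_standard_part M a x" for a x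
    using standard_part_unique[OF M L that] .
  have emb: "L (\<iota> c) = c" for c by (intro eq standard_part_emb M)
  have add: "L (a + b) = L a + L b" for a b by (intro eq standard_part_add M L)
  have nonneg: "0 \<le> L a" if "a \<in> M" for a
    using standard_part_mono[OF M L[of 0] L[of a]] that emb[of 0] by (simp add: emb_0)
  have minus: "L (a - b) = L a - L b" for a b using add[of "a - b" b] by simp
  have multT: "L (t * b) = L t * L b" if t: "t \<in> T" for t b
  proof -
    have lin: "L (t * \<iota> c) = L t * c" if c: "0 < c" for c
    proof (rule eq, unfold is_standard_part_def, intro allI impI conjI)
      fix e :: real assume e: "0 < e"
      have 1: "\<iota> (L t + e / c) - t \<in> M" "t - \<iota> (L t - e / c) \<in> M"
        using L[of t] e c unfolding is_standard_part_def by simp_all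
      have "\<iota> c * (\<iota> (L t + e / c) - t) = \<iota> (L t * c + e) - t * \<iota> c"
        "\<iota> c * (t - \<iota> (L t - e / c)) = t * \<iota> c - \<iota> (L t * c - e)"
        unfolding right_diff_distrib emb_mult[symmetric] using c by (simp_all add: algebra_simps)
      then show "\<iota> (L t * c + e) - t * \<iota> c \<in> M" "t * \<iota> c - \<iota> (L t * c - e) \<in> M"
        using D(3)[OF emb_in[of c] 1(1)] D(3)[OF emb_in[of c] 1(2)] c by simp_all
    qed
    \<comment> \<open>A real number is a difference of two positive ones.\<close>
    have lin: "L (t * \<iota> c) = L t * c" for c
    proof -
      have "t * \<iota> c = t * \<iota> (\<bar>c\<bar> + c + 1) - t * \<iota> (\<bar>c\<bar> + 1)"
        by (simp add: emb_add algebra_simps)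
      then have "L (t * \<iota> c) = L t * (\<bar>c\<bar> + c + 1) - L t * (\<bar>c\<bar> + 1)"
        using lin[of "\<bar>c\<bar> + c + 1"] lin[of "\<bar>c\<bar> + 1"] minus by simp
      then show ?thesis by (simp add: algebra_simps)
    qed
    have t0: "0 \<le> L t" using nonneg D(1) t by blast
    have "L t * (L b - e) \<le> L (t * b) \<and> L (t * b) \<le> L t * (L b + e)" if e: "0 < e" for e
    proof -
      have "t * (\<iota> (L b + e) - b) \<in> M" "t * (b - \<iota> (L b - e)) \<in> M"
        using L[of b] e t D(3) unfolding is_standard_part_def by simp_all
      from this[THEN nonneg] show ?thesis
        unfolding right_diff_distrib minus lin by simp
    qed
    note sandwich = this
    \<comment> \<open>The denominator is \<open>L t + 1\<close> because \<open>L t\<close> may vanish.\<close>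
    have "\<bar>L (t * b) - L t * L b\<bar> \<le> 0 + e" if e: "0 < e" for e
    proof -
      have "L t * (e / (L t + 1)) \<le> e"
        using t0 e by (simp add: field_simps)
      moreover have "0 < e / (L t + 1)" using t0 e by simp
      ultimately show ?thesis
        using sandwich[of "e / (L t + 1)"] unfolding right_diff_distrib distrib_left by linarith
    qed
    then have "\<bar>L (t * b) - L t * L b\<bar> \<le> 0" by (rule field_le_epsilon)
    then show ?thesis by simp
  qed
  have mult: "L (a * b) = L a * L b" for a b
  proof -
    obtain N where N: "0 \<le> N" "\<iota> N - (- a) \<in> T" using bounded_nonneg by blast
    have "a * b = (\<iota> N - (- a)) * b - \<iota> N * b" by (simp add: algebra_simps)
    then have "L (a * b) = (L a + N) * L b - N * L b"
      using multT[OF N(2), of b] multT[OF emb_in[OF N(1)], of b] minus emb add[of a "\<iota> N"]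
      by (simp add: add.commute)
    then show ?thesis by (simp add: algebra_simps)
  qed
  show ?thesis using that[of L] add mult emb nonneg by blast
qed

text \<open>
  If \<open>- 1\<close> were not of the form \<open>t - f s\<close> with \<open>t, s \<in> T\<close>, a maximal proper module containing \<open>- f\<close> would give a character
  at which \<open>f\<close> is nonpositive. So \<open>f s = 1 + t\<close> for some \<open>s, t \<in> T\<close>. With a constant \<open>k > 0\<close> such that \<open>k - s \<in> T\<close>, the
  identity \<open>k (f + r - 1/k) = (k - s)(f + r) + (s f - 1) + r s\<close> shows that \<open>f + r \<in> T\<close> with \<open>r \<ge> 0\<close> can be
  improved to \<open>f + r - 1/k \<in> T\<close>. Starting from some large \<open>r\<close>, finitely many such steps reach \<open>r = 0\<close>.
\<close>
theorem positive_imp_mem: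
  assumes pos: "\<And>L :: 'a \<Rightarrow> real. \<lbrakk>\<And>a b. L (a + b) = L a + L b; \<And>a b. L (a * b) = L a * L b;
      \<And>c. L (\<iota> c) = c; \<And>a. a \<in> T \<Longrightarrow> 0 \<le> L a\<rbrakk> \<Longrightarrow> 0 < L f"
  shows "f \<in> T"
proof -
  have "\<exists>t s. t \<in> T \<and> s \<in> T \<and> - 1 = t + (- f) * s"
  proof (rule ccontr)
    assume no: "\<not> ?thesis"
    let ?M0 = "{t + (- f) * s | t s. t \<in> T \<and> s \<in> T}"
    have closed: "\<forall>m\<in>T. \<forall>t\<in>T. - 1 \<noteq> m + (- f) * t" using no by blast
    have M0: "proper_module ?M0" "T \<subseteq> ?M0" "- f \<in> ?M0"
      by (rule proper_module_adjoin; use add_in mult_in closed in auto)+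
    obtain M where M: "proper_module M" "?M0 \<subseteq> M"
      and max: "\<And>N. proper_module N \<Longrightarrow> M \<subseteq> N \<Longrightarrow> N = M"
      using maximal_proper_module_exists[OF M0(1)] by blast
    obtain L :: "'a \<Rightarrow> real" where L: "\<And>a b. L (a + b) = L a + L b"
      "\<And>a b. L (a * b) = L a * L b" "\<And>c. L (\<iota> c) = c" "\<And>a. a \<in> M \<Longrightarrow> 0 \<le> L a"
      using character_of_total_module[OF M(1) maximal_proper_module_total[OF M(1) max]] by blast
    have "0 < L f" using pos[of L] L M0(2) M(2) by blast
    moreover have "0 \<le> L (- f)" using L(4) M0(3) M(2) by blast
    moreover have "L f + L (- f) = 0" using L(1)[of f "- f"] L(3)[of 0] by (simp add: emb_0)
    ultimately show False by simp
  qed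
  then obtain t s where ts: "t \<in> T" "s \<in> T" "- 1 = t + (- f) * s" by blast
  then have fs: "f * s - 1 = t" by (simp add: algebra_simps)
  obtain k0 where k0: "0 \<le> k0" "\<iota> k0 - s \<in> T" using bounded_nonneg by blast
  define k where "k = k0 + 1"
  have k: "0 < k" using k0 by (simp add: k_def)
  have "\<iota> k - s = (\<iota> k0 - s) + 1" by (simp add: k_def emb_add emb_1)
  then have ks: "\<iota> k - s \<in> T" using add_in[OF k0(2) one_in] by (simp only:)
  have up: "f + \<iota> r' \<in> T" if "f + \<iota> r \<in> T" "r \<le> r'" for r r'
    using add_in[OF that(1) emb_in[of "r' - r"]] that(2) by (simp add: emb_diff)
  have step: "f + \<iota> (r - 1 / k) \<in> T" if "f + \<iota> r \<in> T" "0 \<le> r" for r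
  proof -
    have "(\<iota> k - s) * (f + \<iota> r) + t + \<iota> r * s \<in> T"
      by (rule add_in[OF add_in[OF mult_in[OF ks that(1)] ts(1)]
          mult_in[OF emb_in[OF that(2)] ts(2)]])
    moreover have "(\<iota> k - s) * (f + \<iota> r) + t + \<iota> r * s = \<iota> k * f + \<iota> k * \<iota> r - 1"
      unfolding fs[symmetric] by (simp add: algebra_simps)
    ultimately have "\<iota> (1 / k) * (\<iota> k * f + \<iota> k * \<iota> r - 1) \<in> T"
      using mult_in[OF emb_in[of "1 / k"]] k by simp
    moreover have "\<iota> (1 / k) * \<iota> k = 1" unfolding emb_mult[symmetric] using k emb_1 by simp
    then have "\<iota> (1 / k) * (\<iota> k * f + \<iota> k * \<iota> r - 1) = f + \<iota> (r - 1 / k)"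
      by (simp add: right_diff_distrib distrib_left mult.assoc[symmetric] emb_diff)
    ultimately show ?thesis by simp
  qed
  obtain r0 where r0: "0 \<le> r0" "\<iota> r0 - (- f) \<in> T" using bounded_nonneg by blast
  \<comment> \<open>Truncation at zero keeps the step applicable; a step below zero is undone by adding a constant.\<close>
  have descent: "f + \<iota> (max 0 (r0 - real j / k)) \<in> T" for j
  proof (induction j)
    case 0
    then show ?case using r0 by (simp add: add.commute)
  next
    case (Suc j)
    have "real (Suc j) / k = real j / k + 1 / k" "0 < 1 / k"
      using k by (simp_all add: add_divide_distrib)
    then have "max 0 (r0 - real j / k) - 1 / k \<le> max 0 (r0 - real (Suc j) / k)"
      by linarith
    then show ?case using step[OF Suc] up by simp
  qed
  obtain j :: nat where "r0 * k < real j" using reals_Archimedean2 by blast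
  then have "max 0 (r0 - real j / k) = 0" using k by (simp add: max_def field_simps)
  then show ?thesis using descent[of j] by (simp add: emb_0)
qed

end

section \<open>Evaluation and induction for polynomials\<close>

lemma poly_mapping_additive_induct [case_names zero single add]:
  assumes "P 0" "\<And>k v. P (Poly_Mapping.single k v)" "\<And>f g. P f \<Longrightarrow> P g \<Longrightarrow> P (f + g)"
  shows "P (f :: 'a \<Rightarrow>\<^sub>0 'b::comm_monoid_add)"
proof (induction f rule: update_induct)
  case const
  then show ?case using assms(1) .
next
  case (update f a b)
  have "Poly_Mapping.update a b f = f + Poly_Mapping.single a b"
    using update(1) by (intro poly_mapping_eqI)
      (auto simp: lookup_update lookup_add lookup_single when_def in_keys_iff)
  then show ?case using assms(2,3) update.IH by simp
qed

lemma Const_0: "Const 0 = 0" and Const_1: "Const 1 = 1"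
  and Const_add: "Const (a + b) = Const a + Const b"
  and Const_diff: "Const (a - b) = Const a - Const b"
  and Const_mult: "Const (a * b) = Const a * Const b"
  by (simp_all add: Const_def single_add single_diff mult_single)

lemma Const_sum: "Const (\<Sum>i\<in>S. g i) = (\<Sum>i\<in>S. Const (g i))"
  by (induction S rule: infinite_finite_induct) (simp_all add: Const_0 Const_add)

lemma rpoly_induct [case_names Const Var add mult]:
  assumes Const: "\<And>c. P (Const c)" and Var: "\<And>i. P (Var i)"
    and add: "\<And>p r. P p \<Longrightarrow> P r \<Longrightarrow> P (p + r)" and mult: "\<And>p r. P p \<Longrightarrow> P r \<Longrightarrow> P (p * r)"
  shows "P (p :: 'n rpoly)"
proof -
  have pow: "P (p ^ k)" if "P p" for p and k :: nat
  proof (induction k)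
    case 0
    then show ?case using Const[of 1] by (simp add: Const_1)
  next
    case (Suc k)
    then show ?case using mult that by simp
  qed
  have Var_pow: "Var i ^ k = Poly_Mapping.single (Poly_Mapping.single i k) 1" for i :: 'n and k
    by (induction k) (simp_all add: Var_def mult_single single_add[symmetric])
  have monom: "P (Poly_Mapping.single m 1)" for m :: "'n \<Rightarrow>\<^sub>0 nat"
  proof (induction m rule: poly_mapping_additive_induct)
    case zero
    then show ?case using Const[of 1] by (simp add: Const_def)
  next
    case (single i k)
    then show ?case using pow[OF Var, of i k] by (simp add: Var_pow)
  next
    case (add m m')
    then show ?case using mult[OF add] by (simp add: mult_single)
  qed
  show ?thesis
  proof (induction p rule: poly_mapping_additive_induct)
    case zero
    then show ?case using Const[of 0] by (simp add: Const_0)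
  next
    case (single m c)
    then show ?case using mult[OF Const[of c] monom[of m]] by (simp add: Const_def mult_single)
  next
    case (add p r)
    then show ?case using assms(3) by blast
  qed
qed

lemma peval_superset:
  assumes "finite S" "Poly_Mapping.keys p \<subseteq> S"
  shows "peval p u = (\<Sum>m\<in>S. Poly_Mapping.lookup p m * (\<Prod>i\<in>UNIV. (u $ i) ^ Poly_Mapping.lookup m i))"
  unfolding peval_def using assms
  by (intro sum.mono_neutral_left) (auto simp: in_keys_iff)

lemma peval_single:
  "peval (Poly_Mapping.single m c) u = c * (\<Prod>i\<in>UNIV. (u $ i) ^ Poly_Mapping.lookup m i)"
  by (subst peval_superset[of "{m}"]) auto

lemma peval_add: "peval (p + r) u = peval p u + peval r u"
proof -
  let ?S = "Poly_Mapping.keys p \<union> Poly_Mapping.keys r"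
  have "finite ?S" by simp
  then show ?thesis
    by (subst (1 2 3) peval_superset[of ?S])
      (auto simp: lookup_add distrib_right sum.distrib dest: subsetD[OF keys_add])
qed

lemma peval_mult: "peval (p * r) u = peval p u * peval r u"
proof (induction p rule: poly_mapping_additive_induct)
  case zero
  then show ?case by (simp add: peval_def)
next
  case (single m c)
  show ?case
  proof (induction r rule: poly_mapping_additive_induct)
    case zero
    then show ?case by (simp add: peval_def)
  next
    case (single m' c')
    then show ?case
      by (simp add: mult_single peval_single lookup_add power_add prod.distrib)
  qed (simp add: peval_add distrib_left)
qed (simp add: peval_add distrib_right)

lemma peval_Const: "peval (Const c) u = c"
  by (simp add: Const_def peval_single)

lemma peval_Var: "peval (Var i) u = u $ i"
proof -
  have "(\<Prod>j\<in>UNIV. (u $ j) ^ Poly_Mapping.lookup (Poly_Mapping.single i (1::nat)) j)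
      = (\<Prod>j\<in>UNIV. if j = i then u $ j else 1)"
    by (intro prod.cong) (auto simp: lookup_single)
  then show ?thesis by (simp add: Var_def peval_single)
qed

lemma peval_sum: "peval (\<Sum>i\<in>S. g i) u = (\<Sum>i\<in>S. peval (g i) u)"
  by (induction S rule: infinite_finite_induct) (simp_all add: peval_add peval_def[of 0])

text \<open>The characters of the polynomial ring are the points of the affine space.\<close>
lemma character_eq_peval:
  fixes L :: "'n::finite rpoly \<Rightarrow> real"
  assumes "\<And>p r. L (p + r) = L p + L r" "\<And>p r. L (p * r) = L p * L r" "\<And>c. L (Const c) = c"
  shows "L p = peval p (\<chi> i. L (Var i))"
  by (induction p rule: rpoly_induct)
    (simp_all add: assms peval_Const peval_Var peval_add peval_mult)

text \<open>
  The polynomials bounded on both sides modulo a semiring are closed under products because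
  \<open>2 (N M + p r) = (N + p)(M + r) + (N - p)(M - r)\<close>, and likewise with \<open>r\<close> replaced by \<open>- r\<close>.
\<close>
lemma bounded_rpoly:
  fixes T :: "'n rpoly set"
  assumes add: "\<And>p r. p \<in> T \<Longrightarrow> r \<in> T \<Longrightarrow> p + r \<in> T" and mult: "\<And>p r. p \<in> T \<Longrightarrow> r \<in> T \<Longrightarrow> p * r \<in> T"
    and Const: "\<And>c. 0 \<le> c \<Longrightarrow> Const c \<in> T"
    and Var: "\<And>i. \<exists>N. Const N + Var i \<in> T" "\<And>i. \<exists>N. Const N - Var i \<in> T"
  shows "\<exists>N. Const N + p \<in> T \<and> Const N - p \<in> T"
proof (induction p rule: rpoly_induct)
  case (Const c)
  have "Const (\<bar>c\<bar> + c) \<in> T" "Const (\<bar>c\<bar> - c) \<in> T" by (intro assms(3); simp)+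
  then show ?case unfolding Const_add Const_diff by blast
next
  case (Var i)
  obtain N N' where N: "Const N + Var i \<in> T" "Const N' - Var i \<in> T" using assms(4,5) by blast
  have "Const (max N N' - N) + (Const N + Var i) \<in> T" "Const (max N N' - N') + (Const N' - Var i) \<in> T"
    by (rule assms(1)[OF assms(3) N(1)], simp) (rule assms(1)[OF assms(3) N(2)], simp)
  then show ?case by (intro exI[of _ "max N N'"]) (simp add: Const_diff)
next
  case (add p r)
  then obtain N M where
    "Const N + p \<in> T" "Const N - p \<in> T" "Const M + r \<in> T" "Const M - r \<in> T" by blast
  then have "(Const N + p) + (Const M + r) \<in> T" "(Const N - p) + (Const M - r) \<in> T"
    using assms(1) by blast+
  then show ?case by (intro exI[of _ "N + M"]) (simp add: Const_add algebra_simps)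
next
  case (mult p r)
  then obtain N M where *:
    "Const N + p \<in> T" "Const N - p \<in> T" "Const M + r \<in> T" "Const M - r \<in> T" by blast
  have half: "Const (1/2) * (x + x) = x" for x :: "'n rpoly"
  proof -
    have "Const (1/2) * (x + x) = Const (1/2 + 1/2) * x"
      unfolding Const_add by (simp only: distrib_left distrib_right)
    then show ?thesis by (simp add: Const_1)
  qed
  have "(Const N + p) * (Const M + r) + (Const N - p) * (Const M - r)
      = (Const (N * M) + p * r) + (Const (N * M) + p * r)"
    "(Const N + p) * (Const M - r) + (Const N - p) * (Const M + r)
      = (Const (N * M) - p * r) + (Const (N * M) - p * r)"
    by (simp_all add: Const_mult algebra_simps)
  moreover have "Const (1/2) * ((Const N + p) * (Const M + r) + (Const N - p) * (Const M - r)) \<in> T"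
    "Const (1/2) * ((Const N + p) * (Const M - r) + (Const N - p) * (Const M + r)) \<in> T"
    by (intro assms(1-3) *; simp)+
  ultimately show ?case by (metis half)
qed


section \<open>Certified bounds for linear functionals\<close>

text \<open>
  A pair \<open>(N, d)\<close> stands for the affine function \<open>N + \<langle>d, u\<rangle>\<close>. A qualitative form of Farkas' lemma: every linear
  functional is bounded on a nonempty bounded intersection of half-spaces, and some such bound is certified by
  any convex cone containing the defining inequalities.
\<close>
lemma bounded_imp_cone_meets_vertical_line:
  fixes a :: "'w \<Rightarrow> real" and b :: "'w \<Rightarrow> 'a::euclidean_space" and C :: "(real \<times> 'a) set"
  assumes K: "bounded {u. \<forall>w. 0 \<le> a w + inner (b w) u}" "{u. \<forall>w. 0 \<le> a w + inner (b w) u} \<noteq> {}"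
    and C: "convex C" "cone C" and gen: "\<And>w. (a w, b w) \<in> C"
  shows "\<exists>N. (N, d) \<in> C"
proof (rule ccontr)
  assume "\<nexists>N. (N, d) \<in> C"
  then have disj: "(UNIV \<times> {d}) \<inter> C = {}" by auto
  have "convex ((UNIV :: real set) \<times> {d})" by (intro convex_Times) auto
  then obtain p c where p: "p \<noteq> 0" "\<And>x. x \<in> UNIV \<times> {d} \<Longrightarrow> inner p x \<le> c" "\<And>x. x \<in> C \<Longrightarrow> c \<le> inner p x"
    using separating_hyperplane_sets[OF _ C(1) _ _ disj] gen by blast
  obtain \<alpha> \<beta> where pab: "p = (\<alpha>, \<beta>)" by (cases p)
  \<comment> \<open>The separating functional is bounded on a whole vertical line, so it ignores constants.\<close>
  have \<alpha>: "\<alpha> = 0"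
  proof (rule ccontr)
    assume "\<alpha> \<noteq> 0"
    then show False using p(2)[of "((c - inner \<beta> d + 1) / \<alpha>, d)"] by (simp add: pab)
  qed
  then have \<beta>: "\<beta> \<noteq> 0" using p(1) pab by (simp add: zero_prod_def)
  have nonneg: "0 \<le> inner p x" if x: "x \<in> C" for x
  proof (rule ccontr)
    assume neg: "\<not> 0 \<le> inner p x"
    define t where "t = (\<bar>c\<bar> + 1) / (- inner p x)"
    have "0 \<le> t" using neg by (simp add: t_def divide_le_0_iff)
    then have "t *\<^sub>R x \<in> C" using C(2) x by (simp add: cone_def)
    from p(3)[OF this] have "c \<le> t * inner p x" by simp
    also have "t * inner p x = - (\<bar>c\<bar> + 1)" using neg by (simp add: t_def)
    finally show False by simp
  qed
  \<comment> \<open>So \<open>\<beta>\<close> is a recession direction of the intersection of half-spaces.\<close>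
  have rec: "0 \<le> inner (b w) \<beta>" for w
    using nonneg[OF gen[of w]] by (simp add: pab \<alpha> inner_commute)
  obtain u where u: "\<And>w. 0 \<le> a w + inner (b w) u" using K(2) by blast
  obtain B where B: "\<And>x. (\<And>w. 0 \<le> a w + inner (b w) x) \<Longrightarrow> norm x \<le> B"
    using K(1) unfolding bounded_iff by blast
  define t where "t = (\<bar>B\<bar> + norm u + 1) / norm \<beta>"
  have t: "0 \<le> t" by (simp add: t_def)
  have "norm (u + t *\<^sub>R \<beta>) \<le> B"
  proof (rule B)
    fix w
    show "0 \<le> a w + inner (b w) (u + t *\<^sub>R \<beta>)"
      using u[of w] mult_nonneg_nonneg[OF t rec[of w]] by (simp add: inner_add_right)
  qed
  moreover have "norm (t *\<^sub>R \<beta>) \<le> norm (u + t *\<^sub>R \<beta>) + norm u"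
    using norm_triangle_ineq4[of "u + t *\<^sub>R \<beta>" u] by simp
  moreover have "norm (t *\<^sub>R \<beta>) = \<bar>B\<bar> + norm u + 1" using t \<beta> by (simp add: t_def)
  ultimately show False by linarith
qed

section \<open>Kronecker products and positive semidefinite matrices\<close>

lemma mat_inner_eq_sum:
  assumes "M \<in> carrier_mat n n" "N \<in> carrier_mat n n"
  shows "mat_inner M N = (\<Sum>i<n. \<Sum>j<n. M $$ (i, j) * N $$ (i, j))"
proof -
  have "mat_inner M N = (\<Sum>j<n. \<Sum>i<n. M $$ (i, j) * N $$ (i, j))"
    using assms unfolding mat_inner_def mat_trace_def
    by (auto simp: scalar_prod_def lessThan_atLeast0 intro!: sum.cong)
  also have "\<dots> = (\<Sum>i<n. \<Sum>j<n. M $$ (i, j) * N $$ (i, j))"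
    by (rule sum.swap)
  finally show ?thesis .
qed

text \<open>
  Positive semidefiniteness in terms of entries and coordinate functions, so that all later
  statements reduce to manipulations of double sums.
\<close>
lemma psd_mats_iff:
  "M \<in> psd_mats n \<longleftrightarrow> M \<in> carrier_mat n n \<and> (\<forall>i<n. \<forall>j<n. M $$ (i, j) = M $$ (j, i))
     \<and> (\<forall>w. 0 \<le> (\<Sum>i<n. \<Sum>j<n. w i * w j * M $$ (i, j)))"
proof -
  have sym: "transpose_mat M = M \<longleftrightarrow> (\<forall>i<n. \<forall>j<n. M $$ (i, j) = M $$ (j, i))"
    if "M \<in> carrier_mat n n"
    using that by (auto simp: mat_eq_iff)
  have quad: "v \<bullet> (M *\<^sub>v v) = (\<Sum>i<n. \<Sum>j<n. vec_index v i * vec_index v j * M $$ (i, j))"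
    if "M \<in> carrier_mat n n" "v \<in> carrier_vec n" for v
    using that by (auto simp: scalar_prod_def lessThan_atLeast0 sum_distrib_left ac_simps intro!: sum.cong)
  have "(\<forall>v\<in>carrier_vec n. 0 \<le> v \<bullet> (M *\<^sub>v v))
      \<longleftrightarrow> (\<forall>w. 0 \<le> (\<Sum>i<n. \<Sum>j<n. w i * w j * M $$ (i, j)))" if M: "M \<in> carrier_mat n n"
  proof (intro iffI allI ballI)
    fix w assume "\<forall>v\<in>carrier_vec n. 0 \<le> v \<bullet> (M *\<^sub>v v)"
    then have "0 \<le> vec n w \<bullet> (M *\<^sub>v vec n w)" by simp
    then show "0 \<le> (\<Sum>i<n. \<Sum>j<n. w i * w j * M $$ (i, j))" using quad[OF M, of "vec n w"] by simp
  next
    fix v :: "real vec" assume "\<forall>w. 0 \<le> (\<Sum>i<n. \<Sum>j<n. w i * w j * M $$ (i, j))" "v \<in> carrier_vec n"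
    then show "0 \<le> v \<bullet> (M *\<^sub>v v)" using quad[OF M] by simp
  qed
  then show ?thesis using sym unfolding psd_mats_def sym_mats_def by auto
qed

lemma psd_mats_add: "M \<in> psd_mats n \<Longrightarrow> N \<in> psd_mats n \<Longrightarrow> M + N \<in> psd_mats n"
  by (auto simp: psd_mats_iff distrib_left sum.distrib)

lemma psd_mats_smult: "0 \<le> c \<Longrightarrow> M \<in> psd_mats n \<Longrightarrow> c \<cdot>\<^sub>m M \<in> psd_mats n"
  by (auto simp: psd_mats_iff mult.left_commute[of _ c] sum_distrib_left[symmetric])

lemma zero_mem_psd_mats: "0\<^sub>m n n \<in> psd_mats n"
  by (simp add: psd_mats_iff)

text \<open>The index of a Kronecker product is a pair, encoded as \<open>i * b + j\<close>.\<close>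
lemma sum_div_mod:
  fixes f :: "nat \<Rightarrow> nat \<Rightarrow> 'a::comm_monoid_add"
  shows "(\<Sum>x<a * b. f (x div b) (x mod b)) = (\<Sum>i<a. \<Sum>j<b. f i j)"
proof -
  have "(\<Sum>x<a * b. f (x div b) (x mod b)) = (\<Sum>(i, j)\<in>{..<a} \<times> {..<b}. f i j)"
  proof (rule sum.reindex_bij_witness[of _ "\<lambda>(i, j). i * b + j" "\<lambda>x. (x div b, x mod b)"])
    fix x assume "x \<in> {..<a * b}"
    then have x: "x < a * b" by simp
    then have "0 < b" by (cases b) auto
    then show "(x div b, x mod b) \<in> {..<a} \<times> {..<b}"
      using x by (simp add: less_mult_imp_div_less)
  next
    fix ij assume "ij \<in> {..<a} \<times> {..<b}"
    then obtain i j where ij: "ij = (i, j)" "i < a" "j < b" by auto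
    then show "((case ij of (i, j) \<Rightarrow> i * b + j) div b, (case ij of (i, j) \<Rightarrow> i * b + j) mod b) = ij"
      by simp
    have "i * b + j < Suc i * b" using ij by simp
    also have "\<dots> \<le> a * b" using ij by (intro mult_le_mono1) simp
    finally show "(case ij of (i, j) \<Rightarrow> i * b + j) \<in> {..<a * b}" using ij by simp
  qed auto
  then show ?thesis by (simp add: sum.cartesian_product)
qed

lemma kron_carrier: "A \<in> carrier_mat a a \<Longrightarrow> B \<in> carrier_mat b b \<Longrightarrow> kron A B \<in> carrier_mat (a * b) (a * b)"
  by (auto simp: kron_def)

lemma kron_index:
  assumes "A \<in> carrier_mat a a" "B \<in> carrier_mat b b" "x < a * b" "y < a * b"
  shows "kron A B $$ (x, y) = A $$ (x div b, y div b) * B $$ (x mod b, y mod b)"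
  using assms by (auto simp: kron_def)

lemma kron_pow_carrier: "G \<in> carrier_mat q q \<Longrightarrow> kron_pow G k \<in> carrier_mat (q ^ k) (q ^ k)"
  by (induction k) (auto intro: kron_carrier)

lemma mat_inner_kron:
  assumes A: "A \<in> carrier_mat a a" and B: "B \<in> carrier_mat b b"
    and C: "C \<in> carrier_mat a a" and D: "D \<in> carrier_mat b b"
  shows "mat_inner (kron A B) (kron C D) = mat_inner A C * mat_inner B D"
proof -
  define f where "f i j k l = A $$ (i, k) * C $$ (i, k) * (B $$ (j, l) * D $$ (j, l))" for i j k l
  have "mat_inner (kron A B) (kron C D) = (\<Sum>x<a*b. \<Sum>y<a*b. f (x div b) (x mod b) (y div b) (y mod b))"
    unfolding mat_inner_eq_sum[OF kron_carrier[OF A B] kron_carrier[OF C D]]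
    by (intro sum.cong refl) (simp add: kron_index[OF A B] kron_index[OF C D] f_def ac_simps)
  also have "\<dots> = (\<Sum>i<a. \<Sum>j<b. \<Sum>k<a. \<Sum>l<b. f i j k l)"
    by (simp only: sum_div_mod sum_div_mod[where f = "\<lambda>i j. \<Sum>k<a. \<Sum>l<b. f i j k l"])
  also have "\<dots> = (\<Sum>i<a. \<Sum>k<a. \<Sum>j<b. \<Sum>l<b. f i j k l)"
    by (intro sum.cong refl sum.swap)
  also have "\<dots> = mat_inner A C * mat_inner B D"
    unfolding mat_inner_eq_sum[OF A C] mat_inner_eq_sum[OF B D] f_def
    by (simp only: sum_distrib_right) (simp only: sum_distrib_left)
  finally show ?thesis .
qed

definition rank_one :: "nat \<Rightarrow> (nat \<Rightarrow> real) \<Rightarrow> real mat" where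
  "rank_one n w = mat n n (\<lambda>(i, j). w i * w j)"

lemma rank_one_carrier: "rank_one n w \<in> carrier_mat n n"
  by (simp add: rank_one_def)

text \<open>
  The quadratic form of \<open>w w\<^sup>T \<otimes> B\<close> at \<open>v\<close> is the quadratic form of \<open>B\<close> at the contraction of \<open>v\<close> with \<open>w\<close>.
\<close>
lemma psd_mats_kron_rank_one:
  assumes B: "B \<in> psd_mats b"
  shows "kron (rank_one a w) B \<in> psd_mats (a * b)"
proof -
  have Bc: "B \<in> carrier_mat b b" and Bs: "\<And>i j. i < b \<Longrightarrow> j < b \<Longrightarrow> B $$ (i, j) = B $$ (j, i)"
    and Bp: "\<And>w. 0 \<le> (\<Sum>i<b. \<Sum>j<b. w i * w j * B $$ (i, j))"
    using B unfolding psd_mats_iff by auto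
  have lt: "x div b < a" "x mod b < b" if "x < a * b" for x
    using that by (cases "b = 0"; simp add: less_mult_imp_div_less)+
  have idx: "kron (rank_one a w) B $$ (x, y) = w (x div b) * w (y div b) * B $$ (x mod b, y mod b)"
    if "x < a * b" "y < a * b" for x y
    unfolding kron_index[OF rank_one_carrier Bc that] using lt that by (simp add: rank_one_def)
  show ?thesis unfolding psd_mats_iff
  proof (intro conjI allI impI)
    show "kron (rank_one a w) B \<in> carrier_mat (a * b) (a * b)"
      by (rule kron_carrier[OF rank_one_carrier Bc])
    show "kron (rank_one a w) B $$ (x, y) = kron (rank_one a w) B $$ (y, x)"
      if "x < a * b" "y < a * b" for x y
      using that lt Bs by (simp add: idx)
    fix v :: "nat \<Rightarrow> real"
    define u where "u j = (\<Sum>i<a. w i * v (i * b + j))" for j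
    define f where "f i j k l = (w i * v (i * b + j)) * (w k * v (k * b + l)) * B $$ (j, l)" for i j k l
    have "(\<Sum>x<a*b. \<Sum>y<a*b. v x * v y * kron (rank_one a w) B $$ (x, y))
        = (\<Sum>x<a*b. \<Sum>y<a*b. f (x div b) (x mod b) (y div b) (y mod b))"
      using lt by (intro sum.cong refl) (simp add: idx f_def ac_simps)
    also have "\<dots> = (\<Sum>i<a. \<Sum>j<b. \<Sum>k<a. \<Sum>l<b. f i j k l)"
      by (simp only: sum_div_mod sum_div_mod[where f = "\<lambda>i j. \<Sum>k<a. \<Sum>l<b. f i j k l"])
    also have "\<dots> = (\<Sum>j<b. \<Sum>i<a. \<Sum>l<b. \<Sum>k<a. f i j k l)"
      by (subst sum.swap) (intro sum.cong refl sum.swap)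
    also have "\<dots> = (\<Sum>j<b. \<Sum>l<b. \<Sum>i<a. \<Sum>k<a. f i j k l)"
      by (intro sum.cong refl sum.swap)
    also have "\<dots> = (\<Sum>j<b. \<Sum>l<b. u j * u l * B $$ (j, l))"
      unfolding u_def f_def by (simp only: sum_product) (simp only: sum_distrib_right)
    finally show "0 \<le> (\<Sum>x<a*b. \<Sum>y<a*b. v x * v y * kron (rank_one a w) B $$ (x, y))"
      using Bp by simp
  qed
qed

section \<open>The cone and the semiring of its multipliers\<close>

lemma mat_inner_add_left:
  assumes "M \<in> carrier_mat n n" "M' \<in> carrier_mat n n" "N \<in> carrier_mat n n"
  shows "mat_inner (map_mat Const (M + M')) N
    = mat_inner (map_mat Const M) N + mat_inner (map_mat Const M') N"
  using assms by (subst (1 2 3) mat_inner_eq_sum[of _ n])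
    (auto simp: Const_add distrib_right sum.distrib)

lemma mat_inner_smult_left:
  assumes "M \<in> carrier_mat n n" "N \<in> carrier_mat n n"
  shows "mat_inner (map_mat Const (c \<cdot>\<^sub>m M)) N = Const c * mat_inner (map_mat Const M) N"
  using assms by (subst (1 2) mat_inner_eq_sum[of _ n])
    (auto simp: Const_mult sum_distrib_left mult.assoc)

lemma map_mat_Const_kron:
  "map_mat Const (kron A B) = kron (map_mat Const A) (map_mat Const B)"
proof (rule eq_matI, goal_cases)
  case (1 i j)
  then have *: "i < dim_row A * dim_row B" "j < dim_col A * dim_col B" by (simp_all add: kron_def)
  then have "i div dim_row B < dim_row A" "j div dim_col B < dim_col A"
    "i mod dim_row B < dim_row B" "j mod dim_col B < dim_col B"
    by (cases "dim_row B = 0"; cases "dim_col B = 0"; simp add: less_mult_imp_div_less)+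
  with * show ?case by (simp add: kron_def Const_mult)
qed (simp_all add: kron_def)

text \<open>
  The constant term becomes the summand with \<open>k = 0\<close>, since \<open>1 \<times> 1\<close> positive semidefinite matrices are
  nonnegative numbers and the zeroth Kronecker power is the \<open>1 \<times> 1\<close> identity. This removes the special role of the constant when
  degrees get shifted.
\<close>
lemma handelman_cone_eq:
  "handelman_cone q G = {\<Sum>k\<le>m. mat_inner (map_mat Const (\<Lambda> k)) (kron_pow G k) | m \<Lambda>.
     \<forall>k\<le>m. \<Lambda> k \<in> psd_mats (q ^ k)}" (is "_ = ?R")
proof -
  have zero: "mat_inner (map_mat Const M) (kron_pow G 0) = Const (M $$ (0, 0))"
    if "M \<in> psd_mats 1" for M
    using that by (subst mat_inner_eq_sum[of _ 1]) (auto simp: psd_mats_iff)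
  have split: "(\<Sum>k\<le>m. g k) = g 0 + (\<Sum>k = 1..m. g k)" for g :: "nat \<Rightarrow> 'a rpoly" and m
    by (simp add: sum.atLeast0_atMost_Suc atMost_atLeast0 sum.atLeast_Suc_atMost)
  show ?thesis
  proof (intro Set.set_eqI iffI)
    fix h assume "h \<in> handelman_cone q G"
    then obtain m l0 \<Lambda> where h: "h = Const l0 + (\<Sum>k = 1..m. mat_inner (map_mat Const (\<Lambda> k)) (kron_pow G k))"
      and l0: "0 \<le> l0" and \<Lambda>: "\<forall>k\<in>{1..m}. \<Lambda> k \<in> psd_mats (q ^ k)"
      unfolding handelman_cone_def by blast
    define \<Lambda>' where "\<Lambda>' k = (if k = 0 then mat 1 1 (\<lambda>_. l0) else \<Lambda> k)" for k
    have 0: "\<Lambda>' 0 \<in> psd_mats 1"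
      using l0 by (simp add: \<Lambda>'_def psd_mats_iff zero_le_mult_iff)
    have "\<forall>k\<le>m. \<Lambda>' k \<in> psd_mats (q ^ k)"
      using 0 \<Lambda> by (auto simp: \<Lambda>'_def)
    moreover have "h = (\<Sum>k\<le>m. mat_inner (map_mat Const (\<Lambda>' k)) (kron_pow G k))"
      unfolding split zero[OF 0] h by (simp add: \<Lambda>'_def)
    ultimately show "h \<in> ?R" by blast
  next
    fix h assume "h \<in> ?R"
    then obtain m \<Lambda> where h: "h = (\<Sum>k\<le>m. mat_inner (map_mat Const (\<Lambda> k)) (kron_pow G k))"
      and \<Lambda>: "\<forall>k\<le>m. \<Lambda> k \<in> psd_mats (q ^ k)" by blast
    have 0: "\<Lambda> 0 \<in> psd_mats 1" using \<Lambda>[rule_format, of 0] by simp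
    then have "0 \<le> \<Lambda> 0 $$ (0, 0)"
      by (auto simp: psd_mats_iff dest: spec[of _ "\<lambda>_. 1"])
    moreover have "h = Const (\<Lambda> 0 $$ (0, 0)) + (\<Sum>k = 1..m. mat_inner (map_mat Const (\<Lambda> k)) (kron_pow G k))"
      unfolding h split zero[OF 0] ..
    ultimately show "h \<in> handelman_cone q G"
      using \<Lambda> unfolding handelman_cone_def by (auto intro!: exI)
  qed
qed

lemma handelman_coneI:
  assumes "h = (\<Sum>k\<le>m. mat_inner (map_mat Const (\<Lambda> k)) (kron_pow G k))"
    and "\<And>k. \<Lambda> k \<in> psd_mats (q ^ k)"
  shows "h \<in> handelman_cone q G"
  using assms unfolding handelman_cone_eq by blast

text \<open>Padding with zero matrices allows two members of the cone to be written with sums of equal length.\<close>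
lemma handelman_coneE:
  assumes "h \<in> handelman_cone q G"
  obtains m \<Lambda> where "h = (\<Sum>k\<le>m. mat_inner (map_mat Const (\<Lambda> k)) (kron_pow G k))"
    "\<And>k. \<Lambda> k \<in> psd_mats (q ^ k)" "\<And>k. m < k \<Longrightarrow> \<Lambda> k = 0\<^sub>m (q ^ k) (q ^ k)"
proof -
  from assms obtain m \<Lambda> where *: "h = (\<Sum>k\<le>m. mat_inner (map_mat Const (\<Lambda> k)) (kron_pow G k))"
    "\<forall>k\<le>m. \<Lambda> k \<in> psd_mats (q ^ k)" unfolding handelman_cone_eq by blast
  show ?thesis
    by (rule that[where m = m and \<Lambda> = "\<lambda>k. if k \<le> m then \<Lambda> k else 0\<^sub>m (q ^ k) (q ^ k)"])
      (use * in \<open>auto simp: zero_mem_psd_mats\<close>)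
qed

lemma handelman_cone_Const: "0 \<le> c \<Longrightarrow> Const c \<in> handelman_cone q G"
  unfolding handelman_cone_def
  by (rule CollectI, rule exI[of _ 0], rule exI[of _ c]) simp

context
  fixes q :: nat and G :: "'n::finite rpoly mat"
  assumes G: "G \<in> carrier_mat q q"
begin

lemma handelman_cone_add:
  assumes "h \<in> handelman_cone q G" "h' \<in> handelman_cone q G"
  shows "h + h' \<in> handelman_cone q G"
proof -
  obtain m \<Lambda> where h: "h = (\<Sum>k\<le>m. mat_inner (map_mat Const (\<Lambda> k)) (kron_pow G k))"
    and \<Lambda>: "\<And>k. \<Lambda> k \<in> psd_mats (q ^ k)" "\<And>k. m < k \<Longrightarrow> \<Lambda> k = 0\<^sub>m (q ^ k) (q ^ k)"
    by (rule handelman_coneE[OF assms(1)]) (rule that)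
  obtain m' \<Lambda>' where h': "h' = (\<Sum>k\<le>m'. mat_inner (map_mat Const (\<Lambda>' k)) (kron_pow G k))"
    and \<Lambda>': "\<And>k. \<Lambda>' k \<in> psd_mats (q ^ k)" "\<And>k. m' < k \<Longrightarrow> \<Lambda>' k = 0\<^sub>m (q ^ k) (q ^ k)"
    by (rule handelman_coneE[OF assms(2)]) (rule that)
  have carr: "\<Lambda> k \<in> carrier_mat (q ^ k) (q ^ k)" "\<Lambda>' k \<in> carrier_mat (q ^ k) (q ^ k)" for k
    using \<Lambda>(1)[of k] \<Lambda>'(1)[of k] by (simp_all add: psd_mats_iff)
  have zero: "mat_inner (map_mat Const (0\<^sub>m (q ^ k) (q ^ k))) (kron_pow G k) = 0" for k
    using kron_pow_carrier[OF G, of k]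
    by (subst mat_inner_eq_sum[of _ "q ^ k"]) (auto simp: Const_0)
  have "h = (\<Sum>k\<le>max m m'. mat_inner (map_mat Const (\<Lambda> k)) (kron_pow G k))"
    unfolding h using zero \<Lambda>(2) by (intro sum.mono_neutral_left) auto
  moreover have "h' = (\<Sum>k\<le>max m m'. mat_inner (map_mat Const (\<Lambda>' k)) (kron_pow G k))"
    unfolding h' using zero \<Lambda>'(2) by (intro sum.mono_neutral_left) auto
  ultimately have "h + h' = (\<Sum>k\<le>max m m'. mat_inner (map_mat Const (\<Lambda> k + \<Lambda>' k)) (kron_pow G k))"
    by (simp only: sum.distrib mat_inner_add_left[OF carr kron_pow_carrier[OF G]])
  moreover have "\<Lambda> k + \<Lambda>' k \<in> psd_mats (q ^ k)" for k
    using \<Lambda>(1) \<Lambda>'(1) psd_mats_add by blast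
  ultimately show ?thesis by (rule handelman_coneI)
qed

lemma handelman_cone_scale:
  assumes "0 \<le> c" "h \<in> handelman_cone q G"
  shows "Const c * h \<in> handelman_cone q G"
proof -
  obtain m \<Lambda> where h: "h = (\<Sum>k\<le>m. mat_inner (map_mat Const (\<Lambda> k)) (kron_pow G k))"
    and \<Lambda>: "\<And>k. \<Lambda> k \<in> psd_mats (q ^ k)" and "\<And>k. m < k \<Longrightarrow> \<Lambda> k = 0\<^sub>m (q ^ k) (q ^ k)"
    by (rule handelman_coneE[OF assms(2)]) (rule that)
  have carr: "\<Lambda> k \<in> carrier_mat (q ^ k) (q ^ k)" for k
    using \<Lambda>[of k] by (simp add: psd_mats_iff)
  have "Const c * h = (\<Sum>k\<le>m. mat_inner (map_mat Const (c \<cdot>\<^sub>m \<Lambda> k)) (kron_pow G k))"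
    unfolding h by (simp only: sum_distrib_left mat_inner_smult_left[OF carr kron_pow_carrier[OF G]])
  moreover have "c \<cdot>\<^sub>m \<Lambda> k \<in> psd_mats (q ^ k)" for k
    using \<Lambda> psd_mats_smult assms(1) by blast
  ultimately show ?thesis by (rule handelman_coneI)
qed

text \<open>
  The first factor is the polynomial \<open>w\<^sup>T G w\<close>. Multiplication by it shifts degrees by one and replaces \<open>\<Lambda>\<close>
  by \<open>w w\<^sup>T \<otimes> \<Lambda>\<close>.
\<close>
lemma handelman_cone_mult_quadratic_form:
  assumes "h \<in> handelman_cone q G"
  shows "mat_inner (map_mat Const (rank_one q w)) G * h \<in> handelman_cone q G"
proof -
  obtain m \<Lambda> where h: "h = (\<Sum>k\<le>m. mat_inner (map_mat Const (\<Lambda> k)) (kron_pow G k))"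
    and \<Lambda>: "\<And>k. \<Lambda> k \<in> psd_mats (q ^ k)" and "\<And>k. m < k \<Longrightarrow> \<Lambda> k = 0\<^sub>m (q ^ k) (q ^ k)"
    by (rule handelman_coneE[OF assms]) (rule that)
  have carr: "map_mat Const (\<Lambda> k) \<in> carrier_mat (q ^ k) (q ^ k)" for k
    using \<Lambda>[of k] by (simp add: psd_mats_iff)
  have carr1: "map_mat Const (rank_one q w) \<in> carrier_mat q q"
    by (simp add: rank_one_carrier)
  define \<Lambda>' where "\<Lambda>' k = (case k of 0 \<Rightarrow> 0\<^sub>m 1 1 | Suc k \<Rightarrow> kron (rank_one q w) (\<Lambda> k))" for k
  have "mat_inner (map_mat Const (rank_one q w)) G * h
      = (\<Sum>k\<le>m. mat_inner (map_mat Const (\<Lambda>' (Suc k))) (kron_pow G (Suc k)))"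
    unfolding h sum_distrib_left
    by (simp add: \<Lambda>'_def map_mat_Const_kron mat_inner_kron[OF carr1 carr G kron_pow_carrier[OF G]])
  also have "\<dots> = (\<Sum>k\<le>Suc m. mat_inner (map_mat Const (\<Lambda>' k)) (kron_pow G k))"
    unfolding sum.atMost_Suc_shift
    by (subst mat_inner_eq_sum[of "map_mat Const (\<Lambda>' 0)" 1]) (auto simp: \<Lambda>'_def Const_0)
  finally have "mat_inner (map_mat Const (rank_one q w)) G * h
    = (\<Sum>k\<le>Suc m. mat_inner (map_mat Const (\<Lambda>' k)) (kron_pow G k))" .
  moreover have "\<Lambda>' k \<in> psd_mats (q ^ k)" for k
    using \<Lambda> psd_mats_kron_rank_one zero_mem_psd_mats[of 1] by (cases k) (auto simp: \<Lambda>'_def)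
  ultimately show ?thesis by (rule handelman_coneI)
qed

text \<open>
  Passing to multipliers of the cone provides a semiring for free; closure of the cone itself under products
  would need Kronecker products of arbitrary positive semidefinite matrices.
\<close>
definition handelman_multipliers :: "'n rpoly set" where
  "handelman_multipliers = {p. \<forall>h\<in>handelman_cone q G. p * h \<in> handelman_cone q G}"

lemma handelman_multipliersI:
  "(\<And>h. h \<in> handelman_cone q G \<Longrightarrow> p * h \<in> handelman_cone q G) \<Longrightarrow> p \<in> handelman_multipliers"
  by (simp add: handelman_multipliers_def)

lemma handelman_multipliersD:
  "p \<in> handelman_multipliers \<Longrightarrow> h \<in> handelman_cone q G \<Longrightarrow> p * h \<in> handelman_cone q G"
  by (simp add: handelman_multipliers_def)

lemma handelman_multipliers_subset:
  assumes "p \<in> handelman_multipliers"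
  shows "p \<in> handelman_cone q G"
  using handelman_multipliersD[OF assms handelman_cone_Const[of 1]] by (simp add: Const_1)

lemma handelman_multipliers_closed:
  shows "0 \<le> c \<Longrightarrow> Const c \<in> handelman_multipliers"
    and "p \<in> handelman_multipliers \<Longrightarrow> r \<in> handelman_multipliers \<Longrightarrow> p + r \<in> handelman_multipliers"
    and "p \<in> handelman_multipliers \<Longrightarrow> r \<in> handelman_multipliers \<Longrightarrow> p * r \<in> handelman_multipliers"
    and "mat_inner (map_mat Const (rank_one q w)) G \<in> handelman_multipliers"
proof -
  show "Const c \<in> handelman_multipliers" if "0 \<le> c"
    using handelman_cone_scale[OF that] by (rule handelman_multipliersI)
  show "p + r \<in> handelman_multipliers" if "p \<in> handelman_multipliers" "r \<in> handelman_multipliers"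
    by (rule handelman_multipliersI)
      (simp only: distrib_right handelman_cone_add that[THEN handelman_multipliersD])
  show "p * r \<in> handelman_multipliers" if "p \<in> handelman_multipliers" "r \<in> handelman_multipliers"
    by (rule handelman_multipliersI) (simp only: mult.assoc that[THEN handelman_multipliersD])
  show "mat_inner (map_mat Const (rank_one q w)) G \<in> handelman_multipliers"
    by (rule handelman_multipliersI) (rule handelman_cone_mult_quadratic_form)
qed

end


section \<open>Spectrahedra\<close>

lemma linear_pencil_carrier: "linear_pencil q A0 A \<in> carrier_mat q q"
  by (simp add: linear_pencil_def)

definition quad_form :: "nat \<Rightarrow> real mat \<Rightarrow> (nat \<Rightarrow> real) \<Rightarrow> real" where
  "quad_form q M w = (\<Sum>i<q. \<Sum>j<q. w i * w j * M $$ (i, j))"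

lemma quadratic_form_linear_pencil:
  "mat_inner (map_mat Const (rank_one q w)) (linear_pencil q A0 A)
    = Const (quad_form q A0 w) + (\<Sum>k\<in>UNIV. Const (quad_form q (A k) w) * Var k)"
proof -
  have "mat_inner (map_mat Const (rank_one q w)) (linear_pencil q A0 A)
      = (\<Sum>i<q. \<Sum>j<q. Const (w i * w j * A0 $$ (i, j))
          + (\<Sum>k\<in>UNIV. Const (w i * w j * A k $$ (i, j)) * Var k))"
    by (subst mat_inner_eq_sum[of _ q])
      (auto simp: rank_one_def linear_pencil_def Const_mult distrib_left sum_distrib_left mult.assoc
        intro!: sum.cong)
  also have "\<dots> = Const (quad_form q A0 w)
      + (\<Sum>i<q. \<Sum>j<q. \<Sum>k\<in>UNIV. Const (w i * w j * A k $$ (i, j)) * Var k)"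
    by (simp add: quad_form_def Const_sum sum.distrib)
  also have "(\<Sum>i<q. \<Sum>j<q. \<Sum>k\<in>UNIV. Const (w i * w j * A k $$ (i, j)) * Var k)
      = (\<Sum>k\<in>UNIV. \<Sum>i<q. \<Sum>j<q. Const (w i * w j * A k $$ (i, j)) * Var k)"
    by (rule trans[OF sum.cong[OF refl sum.swap] sum.swap])
  also have "\<dots> = (\<Sum>k\<in>UNIV. Const (quad_form q (A k) w) * Var k)"
    by (simp add: quad_form_def Const_sum sum_distrib_right)
  finally show ?thesis .
qed

text \<open>
  Written as an intersection of half-spaces, the spectrahedron is accessible to the separation argument, and
  its half-spaces correspond to the quadratic forms that the multiplier semiring contains.
\<close>
lemma psd_region_linear_pencil:
  assumes "A0 \<in> sym_mats q" "\<And>i. A i \<in> sym_mats q"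
  shows "psd_region q (linear_pencil q A0 A)
    = {u. \<forall>w. 0 \<le> quad_form q A0 w + inner (\<chi> k. quad_form q (A k) w) u}"
proof -
  let ?G = "linear_pencil q A0 A"
  have sym_entry: "M $$ (i, j) = M $$ (j, i)" if M: "M \<in> sym_mats q" and ij: "i < q" "j < q" for M i j
  proof -
    have "M \<in> carrier_mat q q" "transpose_mat M = M" using M by (simp_all add: sym_mats_def)
    then show ?thesis using ij by (metis carrier_matD index_transpose_mat(1))
  qed
  have idx: "peval (?G $$ (i, j)) u = A0 $$ (i, j) + (\<Sum>k\<in>UNIV. A k $$ (i, j) * u $ k)"
    if "i < q" "j < q" for i j u
    using that by (simp add: linear_pencil_def peval_add peval_sum peval_mult peval_Const peval_Var)
  have "(\<Sum>i<q. \<Sum>j<q. w i * w j * peval (?G $$ (i, j)) u)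
      = peval (mat_inner (map_mat Const (rank_one q w)) ?G) u" for w u
    by (subst mat_inner_eq_sum[of _ q])
      (auto simp: rank_one_def linear_pencil_def peval_sum peval_mult peval_Const intro!: sum.cong)
  then have quad: "(\<Sum>i<q. \<Sum>j<q. w i * w j * peval (?G $$ (i, j)) u)
      = quad_form q A0 w + inner (\<chi> k. quad_form q (A k) w) u" for w u
    by (simp add: quadratic_form_linear_pencil peval_add peval_sum peval_mult peval_Const
        peval_Var inner_vec_def)
  have "map_mat (\<lambda>p. peval p u) ?G \<in> psd_mats q
      \<longleftrightarrow> (\<forall>w. 0 \<le> quad_form q A0 w + inner (\<chi> k. quad_form q (A k) w) u)" for u
    unfolding psd_mats_iff quad[symmetric]
    using linear_pencil_carrier[of q A0 A]
    by (simp add: idx sym_entry[OF assms(1)] sym_entry[OF assms(2)] carrier_matD)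
  then show ?thesis unfolding psd_region_def by simp
qed

theorem theorem3p12:
  fixes q :: nat
    and A0 :: "real mat"
    and A :: "'n::finite \<Rightarrow> real mat"
    and f :: "'n rpoly"
  defines "G \<equiv> linear_pencil q A0 A"
  defines "K \<equiv> psd_region q G"
  assumes "A0 \<in> sym_mats q"
    and "\<And>i. A i \<in> sym_mats q"
    and "compact K"
    and "interior K \<noteq> {}"
    and "\<And>u. u \<in> K \<Longrightarrow> peval f u > 0"
  shows "f \<in> handelman_cone q G"
proof -
  have G: "G \<in> carrier_mat q q" unfolding G_def by (rule linear_pencil_carrier)
  define T where "T = handelman_multipliers q G"
  note T = handelman_multipliers_closed[OF G, folded T_def]
  have K: "K = {u. \<forall>w. 0 \<le> quad_form q A0 w + inner (\<chi> k. quad_form q (A k) w) u}"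
    unfolding K_def G_def by (rule psd_region_linear_pencil) (fact assms)+
  have "K \<noteq> {}" using assms(6) interior_subset by blast
  have "bounded K" using assms(5) by (rule compact_imp_bounded)
  define lin :: "real \<times> (real ^ 'n) \<Rightarrow> 'n rpoly"
    where "lin x = Const (fst x) + (\<Sum>k\<in>UNIV. Const (snd x $ k) * Var k)" for x
  have lin_add: "lin (x + y) = lin x + lin y" for x y
    by (simp add: lin_def Const_add distrib_right sum.distrib)
  have lin_scale: "lin (c *\<^sub>R x) = Const c * lin x" for c x
    by (simp add: lin_def Const_mult distrib_left sum_distrib_left mult.assoc)
  have forms: "lin (quad_form q A0 w, \<chi> k. quad_form q (A k) w) \<in> T" for w
    using T(4)[of w] unfolding G_def quadratic_form_linear_pencil by (simp add: lin_def)
  have "\<exists>N. (N, d) \<in> {x. lin x \<in> T}" for d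
  proof (rule bounded_imp_cone_meets_vertical_line)
    show "convex {x. lin x \<in> T}"
      unfolding convex_def using T by (simp add: lin_add lin_scale)
    show "cone {x. lin x \<in> T}"
      unfolding cone_def using T by (simp add: lin_scale)
  qed (use \<open>K \<noteq> {}\<close> \<open>bounded K\<close> forms K in simp_all)
  then have lin_bounded: "\<exists>N. Const N + (\<Sum>k\<in>UNIV. Const (d $ k) * Var k) \<in> T" for d :: "real ^ 'n"
    by (simp add: lin_def)
  have axis: "(\<Sum>k\<in>UNIV. Const (axis i c $ k) * Var k) = Const c * Var i" for i :: 'n and c
  proof -
    have "(\<Sum>k\<in>UNIV. Const (axis i c $ k) * Var k) = (\<Sum>k\<in>UNIV. if k = i then Const c * Var k else 0)"
      by (intro sum.cong) (auto simp: axis_def Const_0)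
    then show ?thesis by simp
  qed
  have bounded: "\<exists>N. Const N + p \<in> T \<and> Const N - p \<in> T" for p
  proof (rule bounded_rpoly[where T = T])
    show "\<exists>N. Const N + Var i \<in> T" for i
      using lin_bounded[of "axis i 1"] by (simp add: axis Const_1)
    have "Const (- 1) = (- 1 :: 'n rpoly)"
      using Const_diff[of 0 1] by (simp add: Const_0 Const_1)
    then show "\<exists>N. Const N - Var i \<in> T" for i
      using lin_bounded[of "axis i (- 1)"] by (simp add: axis)
  qed (fact T)+
  interpret archimedean_semiring Const T
    by unfold_locales (use T bounded Const_1 Const_add Const_mult in blast)+
  have "f \<in> T"
  proof (rule positive_imp_mem)
    fix L :: "'n rpoly \<Rightarrow> real"
    assume L: "\<And>a b. L (a + b) = L a + L b" "\<And>a b. L (a * b) = L a * L b"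
      "\<And>c. L (Const c) = c" "\<And>a. a \<in> T \<Longrightarrow> 0 \<le> L a"
    define u where "u = (\<chi> i. L (Var i))"
    have L_eq: "L p = peval p u" for p
      unfolding u_def by (rule character_eq_peval[OF L(1-3)])
    have "0 \<le> quad_form q A0 w + inner (\<chi> k. quad_form q (A k) w) u" for w
      using L(4)[OF forms[of w]]
      by (simp add: L_eq lin_def peval_add peval_sum peval_mult peval_Const peval_Var inner_vec_def)
    then have "u \<in> K" unfolding K by blast
    then show "0 < L f" using assms(7) L_eq by simp
  qed
  then show ?thesis unfolding T_def by (rule handelman_multipliers_subset[OF G])
qed

end
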